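(* Let $f_C$ be a conjugate complex polynomial in $\boldsymbol{x}\in\mathbb{C}^n$. Then $f_C(\boldsymbol{x})\in\mathbb{R}$ for all $\boldsymbol{x}\in\mathbb{C}^n$ if and only if the coefficients of any pair of its conjugate monomials are conjugate to each other, i.e., any two monomials $a\,u_C(\boldsymbol{x})$ and $b\,v_C(\boldsymbol{x})$ of $f_C$, with $a,b\in\mathbb{C}$ being their coefficients, that satisfy $\overline{u_C(\boldsymbol{x})}=v_C(\boldsymbol{x})$ must have $\overline{a}=b$.
   Context: A conjugate complex polynomial of degree at most $d$ in $\boldsymbol{x}\in\mathbb{C}^n$ is a function of the form $$f_C(\boldsymbol{x})=\sum_{\ell=0}^d \sum_{k=0}^\ell\,\sum_{1\le i_1\le \dots \le i_k \le n}\,\sum_{1\le j_1 \le \dots \le j_{\ell-k} \le n} a_{i_1\dots i_k,j_1\dots j_{\ell-k}}\,\overline{x_{i_1}\cdots x_{i_k}}\,x_{j_1} \cdots x_{j_{\ell-k}}$$ with complex coefficients $a_{i_1\dots i_k,j_1\dots j_{\ell-k}}$ (empty products equal $1$). The monomials are the functions $\overline{x_{i_1}\cdots x_{i_k}}\,x_{j_1}\cdots x_{j_{\ell-k}}$; a monomial that does not appear has coefficient $0$. The conjugate of the monomial $\overline{x_{i_1}\cdots x_{i_k}}\,x_{j_1}\cdots x_{j_{\ell-k}}$ is the monomial $\overline{x_{j_1}\cdots x_{j_{\ell-k}}}\,x_{i_1}\cdots x_{i_k}$. A monomial may be its own conjugate, in which case the condition says that its coefficient is real. *)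

theory Defs
  imports "HOL-Analysis.Analysis"
begin

text \<open>
  Vectors of \<open>\<complex>\<^sup>n\<close> are elements of \<^typ>\<open>complex ^ 'n\<close>. The linear order on the finite index
  type \<open>'n\<close> plays the role of the order of \<open>1, \<dots>, n\<close>, so that a multi-index
  \<open>i\<^sub>1 \<le> \<dots> \<le> i\<^sub>k\<close> is a sorted list of length \<open>k\<close>.
\<close>

definition multi_indices :: "nat \<Rightarrow> 'n::{finite,linorder} list set" where
  "multi_indices k = {I. length I = k \<and> sorted I}"

lemma finite_multi_indices [simp]: "finite (multi_indices k :: 'n::{finite,linorder} list set)"
  unfolding multi_indices_def
  by (rule finite_subset[OF _ finite_lists_length_eq[of "UNIV :: 'n set" k]]) auto

definition conj_monomial :: "'n list \<Rightarrow> 'n list \<Rightarrow> complex ^ 'n::{finite,linorder} \<Rightarrow> complex" where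
  "conj_monomial I J x = cnj (\<Prod>i\<leftarrow>I. x $ i) * (\<Prod>j\<leftarrow>J. x $ j)"

definition monomial_indices :: "nat \<Rightarrow> ('n::{finite,linorder} list \<times> 'n list) set" where
  "monomial_indices d = (\<Union>l\<in>{0..d}. \<Union>k\<in>{0..l}. multi_indices k \<times> multi_indices (l - k))"

text \<open>
  The coefficient of \<^term>\<open>conj_monomial I J\<close> is \<^term>\<open>a I J\<close>, which may be zero; only the values
  of \<open>a\<close> on \<^term>\<open>monomial_indices d\<close> matter.
\<close>

definition conj_poly ::
  "nat \<Rightarrow> ('n list \<Rightarrow> 'n list \<Rightarrow> complex) \<Rightarrow> complex ^ 'n::{finite,linorder} \<Rightarrow> complex" where
  "conj_poly d a x =
     (\<Sum>l=0..d. \<Sum>k=0..l. \<Sum>I\<in>multi_indices k. \<Sum>J\<in>multi_indices (l - k).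
        a I J * conj_monomial I J x)"

end

theory Submission
  imports Defs
begin

text \<open>
  Conjugation swaps the two index lists of a monomial, so \<open>cnj f\<close> is the conjugate polynomial with
  the coefficients \<open>cnj (a J I)\<close>, and \<open>f\<close> is real-valued iff it agrees with \<open>cnj f\<close> as a function.
  What remains is that a function determines its coefficients \<open>a I J\<close>
  (\<open>conj_poly_coeff_unique\<close>). This rests on two facts about monomials: different pairs of sorted
  lists give different functions (\<open>conj_monomial_inject\<close>), and different monomials are linearly
  independent over \<open>\<complex>\<close>. The first fact also shows that the only monomial equal to the conjugate of
  the one for \<open>(I, J)\<close> is the one for \<open>(J, I)\<close>.

  The second fact holds because every monomial is multiplicative for the componentwise product of
  \<open>\<complex>\<^sup>n\<close>, that is, it is a character of a multiplicative monoid with values in a field, and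
  distinct characters are always linearly independent (Dedekind's lemma,
  \<open>distinct_characters_independent\<close>).

  The first fact is seen on one coordinate at a time: on the points with entry \<open>t\<close> at position
  \<open>i\<close> and \<open>1\<close> elsewhere, the monomial is \<open>cnj t ^ p * t ^ q\<close>, where \<open>p\<close> and \<open>q\<close> count the
  occurrences of \<open>i\<close> in the two lists. Its modulus at \<open>t = 2\<close> determines \<open>p + q\<close>, its argument at
  \<open>t = cis \<theta>\<close> with a small \<open>\<theta> > 0\<close> determines \<open>q - p\<close>.
\<close>

text \<open>
  Dedekind's argument: multiplying a relation evaluated at \<open>x\<close> by the value \<open>\<phi> u y\<close> and subtracting
  it from the relation evaluated at \<open>y * x\<close> cancels the character \<open>\<phi> u\<close>. The shorter relation has
  the coefficients \<open>c s * (\<phi> s y - \<phi> u y)\<close>, and \<open>y\<close> can be chosen so that a given one of the second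
  factors is nonzero.
\<close>

lemma distinct_characters_independent:
  fixes \<phi> :: "'i \<Rightarrow> 'a::times \<Rightarrow> 'b::idom"
  assumes "finite S" and "inj_on \<phi> S"
    and "\<And>s x y. s \<in> S \<Longrightarrow> \<phi> s (x * y) = \<phi> s x * \<phi> s y"
    and "\<And>s. s \<in> S \<Longrightarrow> \<exists>x. \<phi> s x \<noteq> 0"
    and "\<And>x. (\<Sum>s\<in>S. c s * \<phi> s x) = 0"
    and "s \<in> S"
  shows "c s = 0"
  using assms
proof (induction S arbitrary: c s rule: finite_induct)
  case empty
  then show ?case by simp
next
  case (insert u S)
  have others: "c s = 0" if s: "s \<in> S" for s
  proof -
    have "\<phi> s \<noteq> \<phi> u"
      using insert.prems(1) insert.hyps(2) s by (auto simp: inj_on_def)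
    then obtain y where y: "\<phi> s y \<noteq> \<phi> u y" by auto
    have "(\<Sum>s\<in>S. (c s * (\<phi> s y - \<phi> u y)) * \<phi> s x) = 0" for x
    proof -
      have "(\<Sum>s\<in>insert u S. c s * \<phi> s (y * x)) - \<phi> u y * (\<Sum>s\<in>insert u S. c s * \<phi> s x)
          = (\<Sum>s\<in>insert u S. c s * \<phi> s y * \<phi> s x - \<phi> u y * (c s * \<phi> s x))"
        using insert.prems(2) by (simp add: sum_subtractf sum_distrib_left mult.assoc)
      also have "\<dots> = (\<Sum>s\<in>S. c s * \<phi> s y * \<phi> s x - \<phi> u y * (c s * \<phi> s x))"
        using insert.hyps by (simp add: algebra_simps)
      also have "\<dots> = (\<Sum>s\<in>S. (c s * (\<phi> s y - \<phi> u y)) * \<phi> s x)"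
        by (simp add: algebra_simps)
      finally show ?thesis
        by (simp only: insert.prems(4)) simp
    qed
    moreover have "inj_on \<phi> S"
      using insert.prems(1) by simp
    ultimately have "c s * (\<phi> s y - \<phi> u y) = 0"
      using insert.IH[where c = "\<lambda>s. c s * (\<phi> s y - \<phi> u y)" and s = s]
        insert.prems(2,3) s by blast
    with y show ?thesis by simp
  qed
  have "c u = 0"
  proof -
    obtain x where "\<phi> u x \<noteq> 0" using insert.prems(3) by blast
    moreover have "c u * \<phi> u x = 0"
      using insert.prems(4)[of x] insert.hyps others by simp
    ultimately show ?thesis by simp
  qed
  with others insert.prems(5) show ?case by auto
qed

lemma conj_monomial_mult:
  "conj_monomial I J (x * y) = conj_monomial I J x * conj_monomial I J y"
proof -
  have "(\<Prod>i\<leftarrow>K. (x * y) $ i) = (\<Prod>i\<leftarrow>K. x $ i) * (\<Prod>i\<leftarrow>K. y $ i)" for K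
    by (induction K) auto
  then show ?thesis by (simp add: conj_monomial_def)
qed

lemma conj_monomial_one:
  fixes I J :: "'n::{finite,linorder} list"
  shows "conj_monomial I J 1 = 1"
proof -
  have "(\<Prod>i\<leftarrow>K. (1 :: complex ^ 'n::{finite,linorder}) $ i) = 1" for K
    by (induction K) auto
  then show ?thesis by (simp add: conj_monomial_def)
qed

lemma cnj_conj_monomial: "cnj (conj_monomial I J x) = conj_monomial J I x"
  by (simp add: conj_monomial_def)

lemma conj_monomial_coordinate:
  "conj_monomial I J (\<chi> j. if j = i then t else 1)
     = cnj t ^ count (mset I) i * t ^ count (mset J) i"
proof -
  have "(\<Prod>j\<leftarrow>K. (\<chi> j. if j = i then t else 1) $ j) = t ^ count (mset K) i"
    for K :: "'a list"
    by (induction K) auto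
  then show ?thesis by (simp add: conj_monomial_def)
qed

lemma cnj_power_mult_power_inject:
  assumes eq: "\<And>t. cnj t ^ p * t ^ q = cnj t ^ r * t ^ s"
  shows "p = r" and "q = s"
proof -
  have "(2::complex) ^ (p + q) = 2 ^ (r + s)"
    using eq[of 2] by (simp add: power_add)
  then have "(2::real) ^ (p + q) = 2 ^ (r + s)"
    by (metis norm_numeral norm_power)
  then have sums: "p + q = r + s" by simp
  \<comment> \<open>The angle is so small that the relevant multiple of it stays below \<open>\<pi>\<close>.\<close>
  define \<theta> where "\<theta> = 1 / (real p + real q + real r + real s + 1)"
  define m where "m = real q + real r - real p - real s"
  have on_circle: "cnj (cis \<theta>) ^ k * cis \<theta> ^ l = cis ((real l - real k) * \<theta>)" for k l
    by (simp add: cis_cnj Complex.DeMoivre cis_mult algebra_simps)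
  have "cis ((real q - real p) * \<theta>) = cis ((real s - real r) * \<theta>)"
    using eq[of "cis \<theta>"] by (simp only: on_circle)
  moreover have "m * \<theta> = (real q - real p) * \<theta> - (real s - real r) * \<theta>"
    by (simp add: m_def algebra_simps)
  ultimately have "cis (m * \<theta>) = 1"
    by (simp flip: cis_divide)
  then have "sin (m * \<theta>) = 0"
    by (simp add: complex_eq_iff)
  moreover have "\<bar>m * \<theta>\<bar> \<le> 1"
  proof -
    have "\<bar>m\<bar> \<le> real p + real q + real r + real s + 1"
      unfolding m_def by linarith
    then show ?thesis
      unfolding \<theta>_def by (simp add: divide_le_eq_1)
  qed
  ultimately have "m * \<theta> = 0"
    by (intro sin_eq_0_pi[of "m * \<theta>"]) (use pi_gt3 in linarith)+
  moreover have "\<theta> \<noteq> 0"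
    unfolding \<theta>_def by (smt (verit) divide_eq_0_iff of_nat_0_le_iff)
  ultimately have "real q + real r = real p + real s"
    by (simp add: m_def)
  then have "q + r = p + s" by linarith
  with sums show "p = r" "q = s" by linarith+
qed

lemma conj_monomial_inject:
  assumes "sorted I" "sorted J" "sorted K" "sorted L"
    and eq: "conj_monomial I J = conj_monomial K L"
  shows "I = K" and "J = L"
proof -
  have "cnj t ^ count (mset I) i * t ^ count (mset J) i
      = cnj t ^ count (mset K) i * t ^ count (mset L) i" for t i
    using eq by (metis conj_monomial_coordinate)
  then have "count (mset I) i = count (mset K) i" "count (mset J) i = count (mset L) i" for i
    using cnj_power_mult_power_inject by blast+
  then have "mset I = mset K" "mset J = mset L"
    by (auto intro: multiset_eqI)
  with assms(1-4) show "I = K" "J = L"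
    by (metis properties_for_sort)+
qed

lemma monomial_indices_eq:
  "monomial_indices d = {(I, J). sorted I \<and> sorted J \<and> length I + length J \<le> d}"
  by (force simp: monomial_indices_def multi_indices_def)

lemma finite_monomial_indices: "finite (monomial_indices d)"
  by (simp add: monomial_indices_def)

text \<open>
  The double sum over degrees is a sum over the index set without repetitions, because the lengths
  of \<open>I\<close> and \<open>J\<close> determine \<open>k\<close> and \<open>l\<close>.
\<close>

lemma conj_poly_eq_sum:
  fixes a :: "'n::{finite,linorder} list \<Rightarrow> 'n list \<Rightarrow> complex"
  shows "conj_poly d a x = (\<Sum>(I, J)\<in>monomial_indices d. a I J * conj_monomial I J x)"
proof -
  let ?g = "\<lambda>(I, J). a I J * conj_monomial I J x"
  let ?M = "\<lambda>k l. multi_indices k \<times> multi_indices (l - k) :: ('n list \<times> 'n list) set"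
  have "(\<Sum>p\<in>(\<Union>k\<in>{0..l}. ?M k l). ?g p) = (\<Sum>k=0..l. \<Sum>p\<in>?M k l. ?g p)" for l
    by (rule sum.UNION_disjoint) (simp, simp, auto simp: multi_indices_def)
  moreover have "(\<Sum>p\<in>monomial_indices d. ?g p) = (\<Sum>l=0..d. \<Sum>p\<in>(\<Union>k\<in>{0..l}. ?M k l). ?g p)"
    unfolding monomial_indices_def
    by (rule sum.UNION_disjoint) (simp, simp, auto simp: multi_indices_def)
  ultimately show ?thesis
    by (simp add: conj_poly_def sum.cartesian_product)
qed

lemma cnj_conj_poly: "cnj (conj_poly d a x) = conj_poly d (\<lambda>I J. cnj (a J I)) x"
  unfolding conj_poly_eq_sum cnj_sum
  by (rule sum.reindex_bij_witness[where i = prod.swap and j = prod.swap])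
    (auto simp: monomial_indices_eq cnj_conj_monomial)

lemma conj_poly_coeff_unique:
  fixes a b :: "'n::{finite,linorder} list \<Rightarrow> 'n list \<Rightarrow> complex"
  assumes eq: "\<And>x. conj_poly d a x = conj_poly d b x"
    and "(I, J) \<in> monomial_indices d"
  shows "a I J = b I J"
proof -
  let ?\<phi> = "\<lambda>(I :: 'n list, J). conj_monomial I J"
  have "(\<lambda>(I, J). a I J - b I J) (I, J) = 0"
  proof (rule distinct_characters_independent[where \<phi> = ?\<phi>])
    show "finite (monomial_indices d :: ('n list \<times> 'n list) set)"
      by (rule finite_monomial_indices)
    show "inj_on ?\<phi> (monomial_indices d)"
    proof (rule inj_onI)
      fix s t
      assume "s \<in> monomial_indices d" "t \<in> monomial_indices d" "?\<phi> s = ?\<phi> t"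
      then show "s = t"
        using conj_monomial_inject[of "fst s" "snd s" "fst t" "snd t"]
        by (auto simp: monomial_indices_eq)
    qed
    show "?\<phi> s (x * y) = ?\<phi> s x * ?\<phi> s y" for s x y
      by (simp add: conj_monomial_mult split: prod.split)
    show "\<exists>x. ?\<phi> s x \<noteq> 0" for s
      by (rule exI[of _ 1]) (simp add: conj_monomial_one split: prod.split)
    show "(\<Sum>s\<in>monomial_indices d. (\<lambda>(I, J). a I J - b I J) s * ?\<phi> s x) = 0" for x
      using eq[of x]
      by (simp add: conj_poly_eq_sum case_prod_unfold left_diff_distrib sum_subtractf)
  qed (fact assms(2))
  then show ?thesis by simp
qed

theorem theorem3p1:
  fixes d :: nat
    and a :: "'n::{finite,linorder} list \<Rightarrow> 'n list \<Rightarrow> complex"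
    and f :: "complex ^ 'n::{finite,linorder} \<Rightarrow> complex"
  assumes f: "f = conj_poly d a"
  shows "(\<forall>x. f x \<in> \<real>) \<longleftrightarrow>
    (\<forall>(I, J) \<in> monomial_indices d. \<forall>(K, L) \<in> monomial_indices d.
       (\<forall>x :: complex ^ 'n::{finite,linorder}. cnj (conj_monomial I J x) = conj_monomial K L x) \<longrightarrow> cnj (a I J) = a K L)"
proof (intro iffI ballI allI)
  fix IJ :: "'n list \<times> 'n list"
  assume real: "\<forall>x. f x \<in> \<real>" and IJ: "IJ \<in> monomial_indices d"
  obtain I J where [simp]: "IJ = (I, J)" by (cases IJ)
  have "cnj (a I J) = a K L"
    if KL: "(K, L) \<in> monomial_indices d"
      and conj: "\<forall>x. cnj (conj_monomial I J x) = conj_monomial K L x" for K L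
  proof -
    have "conj_monomial J I = conj_monomial K L"
      using conj by (auto simp: cnj_conj_monomial)
    with IJ KL have [simp]: "K = J" "L = I"
      using conj_monomial_inject[of J I K L] by (simp_all add: monomial_indices_eq)
    have "conj_poly d a x = conj_poly d (\<lambda>I J. cnj (a J I)) x" for x
      using real by (metis f Reals_cnj_iff cnj_conj_poly)
    from conj_poly_coeff_unique[OF this KL] show ?thesis by simp
  qed
  then show "case IJ of (I, J) \<Rightarrow> \<forall>(K, L) \<in> monomial_indices d.
      (\<forall>x. cnj (conj_monomial I J x) = conj_monomial K L x) \<longrightarrow> cnj (a I J) = a K L"
    by auto
next
  fix x
  assume coeffs: "\<forall>(I, J) \<in> monomial_indices d. \<forall>(K, L) \<in> monomial_indices d.
    (\<forall>x. cnj (conj_monomial I J x) = conj_monomial K L x) \<longrightarrow> cnj (a I J) = a K L"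
  have "cnj (a J I) = a I J" if "(I, J) \<in> monomial_indices d" for I J
  proof -
    have "(J, I) \<in> monomial_indices d"
      using that by (auto simp: monomial_indices_eq)
    with that coeffs show ?thesis
      using cnj_conj_monomial by blast
  qed
  then have "conj_poly d (\<lambda>I J. cnj (a J I)) x = conj_poly d a x"
    unfolding conj_poly_eq_sum by (intro sum.cong) auto
  then have "cnj (f x) = f x"
    by (simp add: f cnj_conj_poly)
  then show "f x \<in> \<real>"
    by (simp add: Reals_cnj_iff)
qed

end
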